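(* Let $v: G \rightarrow [0,\infty[$ be a bounded weight on a planar domain $G$. If $H^\infty_v(G)$ is a Banach space, then $G$ coincides with the holomorphically convex hull $Hco(E_v)$ in $G$ of the set $E_v:=\{z \in G : v(z)>0 \}$.
   Context: A planar domain is a (nonempty) open connected subset $G$ of $\mathbb{C}$. A weight on $G$ is an arbitrary function $v:G\to[0,\infty[$ (not assumed continuous or strictly positive). $H(G)$ is the space of holomorphic functions on $G$. $H^\infty_v(G):=\{f\in H(G) : \|f\|_v:=\sup_{z\in G} v(z)|f(z)|<+\infty\}$, endowed with the seminorm $\|\cdot\|_v$; saying it is a Banach space means that $\|\cdot\|_v$ is a norm and is complete. For $A\subset G$, the holomorphically convex hull of $A$ in $G$ is $Hco(A):=\{z\in G : |f(z)|\le \sup_{\zeta\in A}|f(\zeta)| \text{ for all } f\in H(G)\}$ (the supremum may be $+\infty$). *)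

theory Defs
  imports "HOL-Complex_Analysis.Complex_Analysis"
begin

definition planar_domain :: "complex set \<Rightarrow> bool" where
  "planar_domain G \<longleftrightarrow> open G \<and> connected G \<and> G \<noteq> {}"

definition weight_on :: "complex set \<Rightarrow> (complex \<Rightarrow> real) \<Rightarrow> bool" where
  "weight_on G v \<longleftrightarrow> (\<forall>z\<in>G. 0 \<le> v z)"

definition bounded_weight_on :: "complex set \<Rightarrow> (complex \<Rightarrow> real) \<Rightarrow> bool" where
  "bounded_weight_on G v \<longleftrightarrow> weight_on G v \<and> bdd_above (v ` G)"

text \<open>A function on \<open>G\<close> is represented by its extension by \<open>0\<close>, so that equality in
  \<open>Hol G\<close> is equality on \<open>G\<close> and the vector space operations are pointwise.\<close>

definition Hol :: "complex set \<Rightarrow> (complex \<Rightarrow> complex) set" where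
  "Hol G = {f. f holomorphic_on G \<and> (\<forall>z. z \<notin> G \<longrightarrow> f z = 0)}"

definition weighted_norm :: "complex set \<Rightarrow> (complex \<Rightarrow> real) \<Rightarrow> (complex \<Rightarrow> complex) \<Rightarrow> real" where
  "weighted_norm G v f = (SUP z\<in>G. v z * cmod (f z))"

text \<open>The real-valued supremum above is only meaningful under the boundedness condition
  imposed here.\<close>

definition Hinf :: "complex set \<Rightarrow> (complex \<Rightarrow> real) \<Rightarrow> (complex \<Rightarrow> complex) set" where
  "Hinf G v = {f \<in> Hol G. bdd_above ((\<lambda>z. v z * cmod (f z)) ` G)}"

definition complex_function_space :: "(complex \<Rightarrow> complex) set \<Rightarrow> bool" where
  "complex_function_space V \<longleftrightarrow>
     (\<lambda>z. 0) \<in> V \<and>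
     (\<forall>f\<in>V. \<forall>g\<in>V. (\<lambda>z. f z + g z) \<in> V) \<and>
     (\<forall>c. \<forall>f\<in>V. (\<lambda>z. c * f z) \<in> V)"

definition seminorm_on ::
  "(complex \<Rightarrow> complex) set \<Rightarrow> ((complex \<Rightarrow> complex) \<Rightarrow> real) \<Rightarrow> bool" where
  "seminorm_on V N \<longleftrightarrow>
     (\<forall>f\<in>V. 0 \<le> N f) \<and>
     (\<forall>c. \<forall>f\<in>V. N (\<lambda>z. c * f z) = cmod c * N f) \<and>
     (\<forall>f\<in>V. \<forall>g\<in>V. N (\<lambda>z. f z + g z) \<le> N f + N g)"

definition norm_on ::
  "(complex \<Rightarrow> complex) set \<Rightarrow> ((complex \<Rightarrow> complex) \<Rightarrow> real) \<Rightarrow> bool" where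
  "norm_on V N \<longleftrightarrow> seminorm_on V N \<and> (\<forall>f\<in>V. N f = 0 \<longrightarrow> f = (\<lambda>z. 0))"

text \<open>The locale \<open>Metric_space\<close> demands nonnegativity and symmetry also off the carrier,
  where \<open>N\<close> is unconstrained; the value \<open>0\<close> there does not affect completeness.\<close>

definition norm_dist ::
  "(complex \<Rightarrow> complex) set \<Rightarrow> ((complex \<Rightarrow> complex) \<Rightarrow> real) \<Rightarrow>
     (complex \<Rightarrow> complex) \<Rightarrow> (complex \<Rightarrow> complex) \<Rightarrow> real" where
  "norm_dist V N f g = (if f \<in> V \<and> g \<in> V then N (\<lambda>z. f z - g z) else 0)"

definition banach_space_on ::
  "(complex \<Rightarrow> complex) set \<Rightarrow> ((complex \<Rightarrow> complex) \<Rightarrow> real) \<Rightarrow> bool" where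
  "banach_space_on V N \<longleftrightarrow>
     complex_function_space V \<and> norm_on V N \<and> Metric_space.mcomplete V (norm_dist V N)"

lemma Metric_space_norm_dist:
  assumes V: "complex_function_space V" and N: "norm_on V N"
  shows "Metric_space V (norm_dist V N)"
proof -
  have add: "(\<lambda>z. f z + g z) \<in> V" if "f \<in> V" "g \<in> V" for f g
    using V that by (auto simp: complex_function_space_def)
  have scale: "(\<lambda>z. c * f z) \<in> V" if "f \<in> V" for c f
    using V that by (auto simp: complex_function_space_def)
  have diff: "(\<lambda>z. f z - g z) \<in> V" if "f \<in> V" "g \<in> V" for f g
    using add[OF that(1) scale[OF that(2), of "-1"]] by simp
  have nonneg: "0 \<le> N f" if "f \<in> V" for f
    using N that by (auto simp: norm_on_def seminorm_on_def)
  have hom: "N (\<lambda>z. c * f z) = cmod c * N f" if "f \<in> V" for c f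
    using N that by (auto simp: norm_on_def seminorm_on_def)
  have tri: "N (\<lambda>z. f z + g z) \<le> N f + N g" if "f \<in> V" "g \<in> V" for f g
    using N that by (auto simp: norm_on_def seminorm_on_def)
  have def0: "f = (\<lambda>z. 0)" if "f \<in> V" "N f = 0" for f
    using N that by (auto simp: norm_on_def)
  show ?thesis
  proof
    show "0 \<le> norm_dist V N f g" for f g
      using diff nonneg by (simp add: norm_dist_def)
    show "norm_dist V N f g = norm_dist V N g f" for f g
      using hom[OF diff[of g f], of "-1"] by (auto simp: norm_dist_def)
    show "norm_dist V N f g = 0 \<longleftrightarrow> f = g" if f: "f \<in> V" and g: "g \<in> V" for f g
    proof
      assume "norm_dist V N f g = 0"
      then have "(\<lambda>z. f z - g z) = (\<lambda>z. 0)"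
        using f g def0[OF diff[OF f g]] by (simp add: norm_dist_def)
      then show "f = g" by (simp add: fun_eq_iff)
    next
      assume "f = g"
      then show "norm_dist V N f g = 0"
        using f hom[OF f, of 0] by (simp add: norm_dist_def)
    qed
    show "norm_dist V N f h \<le> norm_dist V N f g + norm_dist V N g h"
      if "f \<in> V" "g \<in> V" "h \<in> V" for f g h
      using that tri[OF diff[of f g] diff[of g h]] by (simp add: norm_dist_def)
  qed
qed

text \<open>The supremum is taken in the extended reals, so it may be \<open>\<infinity>\<close>; over the empty set it
  is \<open>-\<infinity>\<close>, hence \<open>Hco G {} = {}\<close>.\<close>

definition Hco :: "complex set \<Rightarrow> complex set \<Rightarrow> complex set" where
  "Hco G A = {z \<in> G. \<forall>f\<in>Hol G. ereal (cmod (f z)) \<le> (SUP \<zeta>\<in>A. ereal (cmod (f \<zeta>)))}"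

definition weight_supp :: "complex set \<Rightarrow> (complex \<Rightarrow> real) \<Rightarrow> complex set" where
  "weight_supp G v = {z \<in> G. v z > 0}"

text \<open>For every weight the algebraic conditions hold automatically, so
  \<open>banach_space_on (Hinf G v) (weighted_norm G v)\<close> amounts to definiteness and completeness.\<close>

lemma complex_function_space_Hinf:
  assumes "weight_on G v"
  shows "complex_function_space (Hinf G v)"
proof -
  have add: "(\<lambda>z. f z + g z) \<in> Hinf G v" if f: "f \<in> Hinf G v" and g: "g \<in> Hinf G v" for f g
  proof -
    obtain a where a: "\<And>z. z \<in> G \<Longrightarrow> v z * cmod (f z) \<le> a"
      using f by (auto simp: Hinf_def bdd_above_def)
    obtain b where b: "\<And>z. z \<in> G \<Longrightarrow> v z * cmod (g z) \<le> b"
      using g by (auto simp: Hinf_def bdd_above_def)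
    have "v z * cmod (f z + g z) \<le> a + b" if z: "z \<in> G" for z
    proof -
      have "v z * cmod (f z + g z) \<le> v z * (cmod (f z) + cmod (g z))"
        using assms z by (intro mult_left_mono norm_triangle_ineq) (auto simp: weight_on_def)
      also have "\<dots> \<le> a + b"
        using a[OF z] b[OF z] by (simp add: distrib_left)
      finally show ?thesis .
    qed
    then have "bdd_above ((\<lambda>z. v z * cmod (f z + g z)) ` G)"
      by (rule bdd_aboveI2)
    then show ?thesis
      using f g by (auto simp: Hinf_def Hol_def intro!: holomorphic_intros)
  qed
  have scale: "(\<lambda>z. c * f z) \<in> Hinf G v" if f: "f \<in> Hinf G v" for c f
  proof -
    obtain a where a: "\<And>z. z \<in> G \<Longrightarrow> v z * cmod (f z) \<le> a"
      using f by (auto simp: Hinf_def bdd_above_def)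
    have "v z * cmod (c * f z) \<le> cmod c * a" if z: "z \<in> G" for z
      using mult_left_mono[OF a[OF z], of "cmod c"] by (simp add: norm_mult mult_ac)
    then have "bdd_above ((\<lambda>z. v z * cmod (c * f z)) ` G)"
      by (rule bdd_aboveI2)
    then show ?thesis
      using f by (auto simp: Hinf_def Hol_def intro!: holomorphic_intros)
  qed
  have zero: "(\<lambda>z. 0) \<in> Hinf G v"
    by (auto simp: Hinf_def Hol_def bdd_above_def)
  show ?thesis
    using add scale zero by (simp add: complex_function_space_def)
qed

lemma seminorm_on_Hinf:
  assumes G: "G \<noteq> {}" and v: "weight_on G v"
  shows "seminorm_on (Hinf G v) (weighted_norm G v)"
proof -
  have up: "v z * cmod (f z) \<le> weighted_norm G v f" if "f \<in> Hinf G v" "z \<in> G" for f z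
    using that unfolding weighted_norm_def Hinf_def by (auto intro: cSUP_upper)
  have least: "weighted_norm G v f \<le> a" if "\<And>z. z \<in> G \<Longrightarrow> v z * cmod (f z) \<le> a" for f a
    using that G unfolding weighted_norm_def by (auto intro: cSUP_least)
  have sc: "(\<lambda>z. c * f z) \<in> Hinf G v" if "f \<in> Hinf G v" for c f
    using complex_function_space_Hinf[OF v] that by (auto simp: complex_function_space_def)
  have nonneg: "0 \<le> weighted_norm G v f" if f: "f \<in> Hinf G v" for f
  proof -
    obtain z where z: "z \<in> G" using G by auto
    have "0 \<le> v z * cmod (f z)" using v z by (auto simp: weight_on_def)
    then show ?thesis using up[OF f z] by simp
  qed
  have tri: "weighted_norm G v (\<lambda>z. f z + g z) \<le> weighted_norm G v f + weighted_norm G v g"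
    if f: "f \<in> Hinf G v" and g: "g \<in> Hinf G v" for f g
  proof (rule least)
    fix z assume z: "z \<in> G"
    have "v z * cmod (f z + g z) \<le> v z * (cmod (f z) + cmod (g z))"
      using v z by (intro mult_left_mono norm_triangle_ineq) (auto simp: weight_on_def)
    then show "v z * cmod (f z + g z) \<le> weighted_norm G v f + weighted_norm G v g"
      using up[OF f z] up[OF g z] by (simp add: distrib_left)
  qed
  have le: "weighted_norm G v (\<lambda>z. c * f z) \<le> cmod c * weighted_norm G v f"
    if f: "f \<in> Hinf G v" for c f
  proof (rule least)
    fix z assume z: "z \<in> G"
    show "v z * cmod (c * f z) \<le> cmod c * weighted_norm G v f"
      using mult_left_mono[OF up[OF f z], of "cmod c"] by (simp add: norm_mult mult_ac)
  qed
  have hom: "weighted_norm G v (\<lambda>z. c * f z) = cmod c * weighted_norm G v f"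
    if f: "f \<in> Hinf G v" for c f
  proof (cases "c = 0")
    case True
    then show ?thesis using le[OF f, of 0] nonneg[OF sc[OF f, of 0]] by simp
  next
    case False
    have "weighted_norm G v f \<le> cmod (inverse c) * weighted_norm G v (\<lambda>z. c * f z)"
      using le[OF sc[OF f, of c], of "inverse c"] False by (simp flip: mult.assoc)
    then have "cmod c * weighted_norm G v f \<le> weighted_norm G v (\<lambda>z. c * f z)"
      using False by (simp add: norm_inverse norm_divide field_simps)
    then show ?thesis using le[OF f, of c] by simp
  qed
  show ?thesis
    using nonneg tri hom by (simp add: seminorm_on_def)
qed

end

theory Submission
  imports Defs
begin

text \<open>
  Write \<open>E\<close> for the set where the weight is positive. The seminorm sees only the values on \<open>E\<close>.
  Because the weight is bounded, uniform convergence on \<open>E\<close> implies convergence in the seminorm,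
  so a Banach space contains a holomorphic function that continues every uniform limit on \<open>E\<close> of
  its members (\<open>uniform_limit_extends\<close>). Because the seminorm is a norm, \<open>E\<close> is a set of
  uniqueness for \<open>Hol G\<close> (\<open>eq_on_weight_supp\<close>).

  If a point \<open>w\<close> were outside the hull, some holomorphic \<open>f\<close>, after division by \<open>f w\<close>, would
  satisfy \<open>f w = 1\<close> and \<open>\<bar>f\<bar> \<le> q < 1\<close> on \<open>E\<close>. The geometric series of \<open>f\<close> converges uniformly
  on \<open>E\<close>, so there is a holomorphic \<open>g\<close> on \<open>G\<close> with \<open>g (1 - f) = 1\<close> on \<open>E\<close>, hence on
  all of \<open>G\<close>. At \<open>w\<close> this reads \<open>0 = 1\<close>. The detour through \<open>g\<close> replaces evaluating the
  series at \<open>w\<close>: norm convergence yields convergence of the values at points of \<open>E\<close> only, since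
  the weight vanishes elsewhere.
\<close>

lemma weighted_norm_upper:
  assumes "f \<in> Hinf G v" "z \<in> G"
  shows "v z * cmod (f z) \<le> weighted_norm G v f"
  using assms unfolding weighted_norm_def Hinf_def by (auto intro: cSUP_upper)

lemma weight_mult_le:
  assumes "weight_on G v" and M: "\<And>z. z \<in> G \<Longrightarrow> v z \<le> M" and "0 \<le> c"
    and c: "\<And>z. z \<in> weight_supp G v \<Longrightarrow> cmod (f z) \<le> c" and "z \<in> G"
  shows "v z * cmod (f z) \<le> M * c"
proof -
  have v: "0 \<le> v z" and M0: "0 \<le> M"
    using assms(1) M[OF \<open>z \<in> G\<close>] \<open>z \<in> G\<close> by (force simp: weight_on_def)+
  show ?thesis
  proof (cases "v z = 0")
    case True
    then show ?thesis using M0 \<open>0 \<le> c\<close> by simp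
  next
    case False
    then have "cmod (f z) \<le> c"
      using v \<open>z \<in> G\<close> by (intro c) (simp add: weight_supp_def)
    then show ?thesis
      using M[OF \<open>z \<in> G\<close>] M0 by (intro mult_mono) auto
  qed
qed

lemma Hinf_if_bounded_on_weight_supp:
  assumes "bounded_weight_on G v" and f: "f \<in> Hol G"
    and c: "\<And>z. z \<in> weight_supp G v \<Longrightarrow> cmod (f z) \<le> c"
  shows "f \<in> Hinf G v"
proof -
  obtain M where M: "\<And>z. z \<in> G \<Longrightarrow> v z \<le> M"
    using assms(1) by (auto simp: bounded_weight_on_def bdd_above_def)
  have v: "weight_on G v"
    using assms(1) by (simp add: bounded_weight_on_def)
  have c': "cmod (f z) \<le> max 0 c" if "z \<in> weight_supp G v" for z
    using c[OF that] by simp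
  have "v z * cmod (f z) \<le> M * max 0 c" if "z \<in> G" for z
    by (rule weight_mult_le[OF v M _ c' that]) auto
  then have "bdd_above ((\<lambda>z. v z * cmod (f z)) ` G)"
    by (rule bdd_aboveI2)
  with f show ?thesis
    by (simp add: Hinf_def)
qed

lemma Hol_extend_by_zero:
  assumes "h holomorphic_on G"
  shows "(\<lambda>z. if z \<in> G then h z else 0) \<in> Hol G"
  using assms by (auto simp: Hol_def cong: holomorphic_cong)

text \<open>The difference of \<open>f\<close> and \<open>g\<close> has seminorm zero, whatever its growth outside the support
  of the weight.\<close>

lemma eq_on_weight_supp:
  assumes norm: "norm_on (Hinf G v) (weighted_norm G v)"
    and v: "weight_on G v" and f: "f holomorphic_on G" and g: "g holomorphic_on G"
    and eq: "\<And>z. z \<in> weight_supp G v \<Longrightarrow> f z = g z" and "z \<in> G"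
  shows "f z = g z"
proof -
  define h where "h = (\<lambda>z. if z \<in> G then f z - g z else 0)"
  have hol: "h \<in> Hol G"
    unfolding h_def by (intro Hol_extend_by_zero holomorphic_intros f g)
  have zero: "v x * cmod (h x) = 0" if "x \<in> G" for x
    using v eq[of x] that by (force simp: h_def weight_on_def weight_supp_def)
  have img: "(\<lambda>z. v z * cmod (h z)) ` G = {0}"
    using zero \<open>z \<in> G\<close> by force
  have "h \<in> Hinf G v"
    using hol by (simp add: Hinf_def img)
  moreover have "weighted_norm G v h = 0"
    by (simp add: weighted_norm_def img)
  ultimately have "h = (\<lambda>z. 0)"
    using norm by (simp add: norm_on_def)
  then have "h z = 0"
    by simp
  then show ?thesis
    using \<open>z \<in> G\<close> by (simp add: h_def)
qed

text \<open>Uniform closeness on the support is closeness in the norm up to the factor \<open>M\<close>, a bound of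
  the weight, so the sequence is Cauchy. Its norm limit agrees with \<open>h\<close> on the support, where the
  norm controls the values.\<close>

lemma uniform_limit_extends:
  assumes G: "G \<noteq> {}" and bw: "bounded_weight_on G v"
    and banach: "banach_space_on (Hinf G v) (weighted_norm G v)"
    and s: "\<And>n. s n \<in> Hinf G v"
    and lim: "uniform_limit (weight_supp G v) s h sequentially"
  obtains g where "g \<in> Hol G" "\<And>z. z \<in> weight_supp G v \<Longrightarrow> g z = h z"
proof -
  define V where "V = Hinf G v"
  define d where "d = norm_dist V (weighted_norm G v)"
  have wt: "weight_on G v"
    using bw by (simp add: bounded_weight_on_def)
  have space: "complex_function_space V"
    and norm: "norm_on V (weighted_norm G v)" and complete: "Metric_space.mcomplete V d"
    using banach by (auto simp: banach_space_on_def V_def d_def)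
  interpret Metric_space V d
    unfolding d_def using space norm by (rule Metric_space_norm_dist)
  have d_eq: "d f g = weighted_norm G v (\<lambda>z. f z - g z)" if "f \<in> V" "g \<in> V" for f g
    using that by (simp add: d_def norm_dist_def)
  have scale: "(\<lambda>z. c * f z) \<in> V" if "f \<in> V" for c f
    using space that by (auto simp: complex_function_space_def)
  have add: "(\<lambda>z. f z + g z) \<in> V" if "f \<in> V" "g \<in> V" for f g
    using space that by (auto simp: complex_function_space_def)
  have diff: "(\<lambda>z. f z - g z) \<in> V" if "f \<in> V" "g \<in> V" for f g
    using add[OF that(1) scale[OF that(2), of "-1"]] by simp
  obtain M where M: "\<And>z. z \<in> G \<Longrightarrow> v z \<le> M" and "0 < M"
  proof -
    obtain B where "\<And>z. z \<in> G \<Longrightarrow> v z \<le> B"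
      using bw by (auto simp: bounded_weight_on_def bdd_above_def)
    then show ?thesis
      using that[of "max 1 B"] by fastforce
  qed
  have "MCauchy s"
    unfolding MCauchy_def
  proof (intro conjI allI impI)
    show "range s \<subseteq> V"
      using s by (auto simp: V_def)
    fix \<epsilon> :: real assume "0 < \<epsilon>"
    define \<delta> where "\<delta> = \<epsilon> / (2 * M)"
    have "0 < \<delta>"
      using \<open>0 < \<epsilon>\<close> \<open>0 < M\<close> by (simp add: \<delta>_def)
    moreover have "uniformly_Cauchy_on (weight_supp G v) s"
      using lim by (auto simp flip: uniformly_convergent_eq_Cauchy simp: uniformly_convergent_on_def)
    ultimately obtain N where
      N: "\<And>x m n. x \<in> weight_supp G v \<Longrightarrow> N \<le> m \<Longrightarrow> N \<le> n \<Longrightarrow> dist (s m x) (s n x) < \<delta>"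
      unfolding uniformly_Cauchy_on_def by meson
    have "d (s m) (s n) < \<epsilon>" if "N \<le> m" "N \<le> n" for m n
    proof -
      have le: "cmod (s m x - s n x) \<le> \<delta>" if "x \<in> weight_supp G v" for x
        using N[OF that \<open>N \<le> m\<close> \<open>N \<le> n\<close>] by (simp add: dist_norm)
      have "weighted_norm G v (\<lambda>z. s m z - s n z) \<le> M * \<delta>"
        unfolding weighted_norm_def
        using weight_mult_le[where f = "\<lambda>z. s m z - s n z", OF wt M _ le] \<open>0 < \<delta>\<close> G
        by (intro cSUP_least) auto
      also have "\<dots> < \<epsilon>"
        using \<open>0 < \<epsilon>\<close> \<open>0 < M\<close> by (simp add: \<delta>_def)
      finally show ?thesis
        using s by (simp add: d_eq V_def)
    qed
    then show "\<exists>N. \<forall>n n'. N \<le> n \<longrightarrow> N \<le> n' \<longrightarrow> d (s n) (s n') < \<epsilon>"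
      by blast
  qed
  then obtain g where g: "limitin mtopology s g sequentially"
    using complete by (auto simp: mcomplete_def)
  then have gV: "g \<in> V"
    by (simp add: limitin_mspace)
  have dist0: "(\<lambda>n. d (s n) g) \<longlonglongrightarrow> 0"
    using g by (simp add: limitin_metric_dist_null)
  have "g z = h z" if z: "z \<in> weight_supp G v" for z
  proof -
    have "z \<in> G" "0 < v z"
      using z by (auto simp: weight_supp_def)
    have "cmod (s n z - g z) \<le> d (s n) g / v z" for n
    proof -
      have "s n \<in> V"
        using s by (simp add: V_def)
      then have "v z * cmod (s n z - g z) \<le> d (s n) g"
        using weighted_norm_upper[of "\<lambda>z. s n z - g z" G v z] diff gV \<open>z \<in> G\<close>
        by (simp add: d_eq V_def)
      then show ?thesis
        using \<open>0 < v z\<close> by (simp add: field_simps)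
    qed
    moreover have "(\<lambda>n. d (s n) g / v z) \<longlonglongrightarrow> 0"
      using tendsto_divide[OF dist0 tendsto_const[of "v z"]] \<open>0 < v z\<close> by simp
    ultimately have "(\<lambda>n. s n z - g z) \<longlonglongrightarrow> 0"
      by (rule Lim_null_comparison[OF always_eventually[OF allI]])
    then have "(\<lambda>n. s n z) \<longlonglongrightarrow> g z"
      by (simp add: LIM_zero_iff)
    moreover have "(\<lambda>n. s n z) \<longlonglongrightarrow> h z"
      using lim z by (rule tendsto_uniform_limitI)
    ultimately show ?thesis
      by (rule LIMSEQ_unique)
  qed
  moreover have "g \<in> Hol G"
    using gV by (simp add: V_def Hinf_def)
  ultimately show ?thesis
    using that by blast
qed

text \<open>The value \<open>1\<close> is excluded on all of \<open>G\<close>, although \<open>f\<close> is small only on the support: the sum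
  of the geometric series continues from the support to an inverse of \<open>1 - f\<close> on \<open>G\<close>.\<close>

lemma ne_1_if_small_on_weight_supp:
  assumes bw: "bounded_weight_on G v"
    and banach: "banach_space_on (Hinf G v) (weighted_norm G v)"
    and f: "f holomorphic_on G" and "q < 1"
    and q: "\<And>z. z \<in> weight_supp G v \<Longrightarrow> cmod (f z) \<le> q" and "w \<in> G"
  shows "f w \<noteq> 1"
proof
  assume "f w = 1"
  define s where "s = (\<lambda>n z. if z \<in> G then \<Sum>k<n. f z ^ k else 0)"
  define r where "r = max 0 q"
  have r: "0 \<le> r" "r < 1" and fr: "\<And>z. z \<in> weight_supp G v \<Longrightarrow> cmod (f z) \<le> r"
    using \<open>q < 1\<close> q by (fastforce simp: r_def)+
  have pow: "cmod (f z ^ k) \<le> r ^ k" if "z \<in> weight_supp G v" for z k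
    using fr[OF that] by (simp add: norm_power power_mono)
  have "uniform_limit (weight_supp G v) (\<lambda>n z. \<Sum>k<n. f z ^ k) (\<lambda>z. \<Sum>k. f z ^ k) sequentially"
    using pow r by (intro Weierstrass_m_test[of _ _ "\<lambda>k. r ^ k"]) (auto intro: summable_geometric)
  then have lim: "uniform_limit (weight_supp G v) s (\<lambda>z. \<Sum>k. f z ^ k) sequentially"
    by (rule uniform_limit_cong'[THEN iffD1, rotated 2]) (auto simp: s_def weight_supp_def)
  have s: "s n \<in> Hinf G v" for n
  proof (rule Hinf_if_bounded_on_weight_supp[OF bw])
    show "s n \<in> Hol G"
      unfolding s_def by (intro Hol_extend_by_zero holomorphic_intros f)
    show "cmod (s n z) \<le> (\<Sum>k<n. r ^ k)" if "z \<in> weight_supp G v" for z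
      using that pow[OF that] by (auto simp: s_def weight_supp_def intro!: sum_norm_le)
  qed
  have "G \<noteq> {}"
    using \<open>w \<in> G\<close> by blast
  then obtain g where g: "g \<in> Hol G"
    and gs: "\<And>z. z \<in> weight_supp G v \<Longrightarrow> g z = (\<Sum>k. f z ^ k)"
    using uniform_limit_extends[OF _ bw banach s lim] by blast
  have inv: "g z * (1 - f z) = 1" if "z \<in> weight_supp G v" for z
  proof -
    have "cmod (f z) < 1"
      using fr[OF that] r by simp
    then show ?thesis
      using gs[OF that] by (auto simp: suminf_geometric)
  qed
  have hol: "(\<lambda>z. g z * (1 - f z)) holomorphic_on G"
    using g by (intro holomorphic_intros f) (simp add: Hol_def)
  have norm: "norm_on (Hinf G v) (weighted_norm G v)" and wt: "weight_on G v"
    using banach bw by (simp_all add: banach_space_on_def bounded_weight_on_def)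
  have "g w * (1 - f w) = 1"
    using eq_on_weight_supp[OF norm wt hol holomorphic_on_const inv \<open>w \<in> G\<close>] .
  then show False
    using \<open>f w = 1\<close> by simp
qed

theorem proposition3p5:
  fixes G :: "complex set" and v :: "complex \<Rightarrow> real"
  assumes "planar_domain G"
    and "bounded_weight_on G v"
    and "banach_space_on (Hinf G v) (weighted_norm G v)"
  shows "G = Hco G (weight_supp G v)"
proof
  show "Hco G (weight_supp G v) \<subseteq> G"
    by (auto simp: Hco_def)
  show "G \<subseteq> Hco G (weight_supp G v)"
  proof (rule ccontr)
    assume "\<not> G \<subseteq> Hco G (weight_supp G v)"
    then obtain w where w: "w \<in> G" "w \<notin> Hco G (weight_supp G v)"
      by blast
    then obtain f where f: "f \<in> Hol G"
      and "\<not> ereal (cmod (f w)) \<le> (SUP \<zeta>\<in>weight_supp G v. ereal (cmod (f \<zeta>)))"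
      unfolding Hco_def by blast
    then have lt: "(SUP \<zeta>\<in>weight_supp G v. ereal (cmod (f \<zeta>))) < ereal (cmod (f w))"
      by (simp only: not_le)
    obtain r where r: "(SUP \<zeta>\<in>weight_supp G v. ereal (cmod (f \<zeta>))) < ereal r" "r < cmod (f w)"
      using ereal_dense2[OF lt] by auto
    have bound: "cmod (f z) \<le> r" if "z \<in> weight_supp G v" for z
      using less_imp_le[OF le_less_trans[OF SUP_upper[OF that] r(1)]] by simp
    \<comment> \<open>Over an empty support the supremum is \<open>-\<infinity>\<close> and \<open>f w\<close> could vanish. The constant \<open>1\<close>
      rules this case out.\<close>
    have "weight_supp G v \<noteq> {}"
      using ne_1_if_small_on_weight_supp[OF assms(2,3), of "\<lambda>_. 1" 0 w] w by auto
    then have "0 \<le> r"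
      using bound norm_ge_zero order_trans by blast
    then have fw: "0 < cmod (f w)"
      using r(2) by linarith
    have "(\<lambda>z. f z / f w) holomorphic_on G"
      using f fw by (intro holomorphic_intros) (auto simp: Hol_def)
    moreover have "r / cmod (f w) < 1"
      using r(2) fw by simp
    moreover have "cmod (f z / f w) \<le> r / cmod (f w)" if "z \<in> weight_supp G v" for z
      using bound[OF that] fw by (simp add: norm_divide divide_right_mono)
    ultimately have "f w / f w \<noteq> 1"
      using ne_1_if_small_on_weight_supp[OF assms(2,3)] w by blast
    then show False
      using fw by simp
  qed
qed

end
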